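(* Let $m\ge1$ and let $(f_1,\dots,f_m)$ be a perfect system of formal power series over the division ring $\mathbb{D}$, i.e. for all $n\in\mathbb{Z}_{\ge0}^m$ and all $i=1,\dots,m$ the quasideterminant $\rho^i(n)$ exists and is nonzero. Then for all $n\in\mathbb{Z}^m_{\ge0}$ the vector $\boldsymbol{\psi}(n,x)=(\psi_1(n,x),\dots,\psi_m(n,x))$ of polynomials, which provides a solution of the non-commutative Hermite--Padé problem, satisfies $$x\,\boldsymbol{\psi}(n,x)=\boldsymbol{\psi}(n+e_1,x)\,\rho^1(n+e_1)[\rho^1(n)]^{-1}+\dots+\boldsymbol{\psi}(n+e_m,x)\,\rho^m(n+e_m)[\rho^m(n)]^{-1},$$ and the quasideterminants satisfy $$1=\rho^1(n+e_1)[\rho^1(n)]^{-1}+\dots+\rho^m(n+e_m)[\rho^m(n)]^{-1}.$$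
   Context: $\mathbb{D}$ is a (not necessarily commutative) division ring; $f_i(x)=\sum_{j\ge0}f^i_jx^j$, $i=1,\dots,m$, are formal power series with coefficients $f^i_j\in\mathbb{D}$, where $x$ commutes with all elements of $\mathbb{D}$; put $f^i_j=0$ for $j<0$. For $n=(n_1,\dots,n_m)\in\mathbb{Z}_{\ge-1}^m$ write $|n|=n_1+\dots+n_m$; $e_i$ denotes the $i$th standard basis vector of $\mathbb{Z}^m$. The Hermite--Padé problem of degree $n$ asks for polynomials $(Y_1,\dots,Y_m)$ in $\mathbb{D}[x]$, not all zero, with $\deg Y_i\le n_i$ (the zero polynomial has degree $-1$), such that $f_1(x)Y_1(x)+\dots+f_m(x)Y_m(x)=x^{|n|+m-1}\Gamma(x)$ for some $\Gamma(x)\in\mathbb{D}[[x]]$. Quasideterminant: for a square matrix $X$, let $X^{pq}$ be $X$ with row $p$ and column $q$ deleted. If $X^{pq}$ is invertible, $|X|_{pq}=x_{pq}-r\,(X^{pq})^{-1}c$, where $r$ is row $p$ of $X$ without its $q$th entry and $c$ is column $q$ of $X$ without its $p$th entry (for a $1\times1$ matrix, $|X|_{11}=x_{11}$); the quasideterminant is said to exist when $X^{pq}$ is invertible. When $X$ is invertible and $(X^{-1})_{qp}\ne0$, it equals $((X^{-1})_{qp})^{-1}$. Matrix $\mathcal{M}(n)$: it has $|n|+m-1$ rows, indexed $r=0,\dots,|n|+m-2$, and $|n|+m$ columns divided into $m$ consecutive blocks; the $i$th block has $n_i+1$ columns indexed $c=0,\dots,n_i$ (empty if $n_i=-1$), and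 the entry in row $r$ and column $c$ of block $i$ is $f^i_{r-c}$. For $n_i\ge0$, $\rho^i(n)$ is the quasideterminant, with respect to the element in the last row and the last column of the $i$th block, of the square matrix obtained from $\mathcal{M}(n)$ by adding as last row the row $r=|n|+m-1$ given by the same rule (entries $f^l_{|n|+m-1-c}$, $c=0,\dots,n_l$, in block $l$). For $n_i\ge0$ and $k\in\{1,\dots,m\}$, $Z_k^{(i)}(n,x)$ is the quasideterminant, with respect to the element in the last row and the last column of the $i$th block, of the square matrix obtained from $\mathcal{M}(n)$ by adding as last row $X_k=(0,\dots,0,1,x,\dots,x^{n_k},0,\dots,0)$, which is zero except in block $k$, where it equals $(1,x,\dots,x^{n_k})$. (The submatrix to be inverted is the same as for $\rho^i(n)$ and has entries in $\mathbb{D}$.) $\psi_k(n,x)=Z_k^{(i)}(n,x)[\rho^i(n)]^{-1}$, where $i$ is any index with $n_i\ge0$ for which $\rho^i(n)$ exists and is nonzero (the result does not depend on the choice of such $i$). Elements of $\mathbb{D}$ multiply vectors of polynomials componentwise from the right. *)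

theory Defs
  imports
    "HOL-Computational_Algebra.Polynomial_FPS"
    "Jordan_Normal_Form.Determinant"
begin

text \<open>Indices \<open>1, \<dots>, m\<close> are natural numbers; systems \<open>f\<close> and multi-indices \<open>n\<close> are
  functions on \<open>nat\<close> of which only the values on \<open>{1..m}\<close> matter. Polynomials are the range of \<^const>\<open>fps_of_poly\<close>
  inside the ring \<open>'a fps\<close>, in which \<^const>\<open>fps_X\<close> is central.\<close>

definition mat_inv :: "'a::ring_1 mat \<Rightarrow> 'a mat" where
  "mat_inv A = (THE B. inverts_mat A B \<and> inverts_mat B A)"

definition quasidet_exists :: "'a::ring_1 mat \<Rightarrow> nat \<Rightarrow> nat \<Rightarrow> bool" where
  "quasidet_exists X p q \<longleftrightarrow> invertible_mat (mat_delete X p q)"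

text \<open>The meaningful case is \<^prop>\<open>quasidet_exists X p q\<close>; positions are counted from 0. A
  \<open>1 \<times> 1\<close> matrix needs no special clause: its deleted matrix is the invertible
  \<open>0 \<times> 0\<close> matrix, and the subtracted product is an empty sum.\<close>

definition quasidet :: "'a::ring_1 mat \<Rightarrow> nat \<Rightarrow> nat \<Rightarrow> 'a" where
  "quasidet X p q =
    (let r = vec (dim_col X - 1) (\<lambda>j. X $$ (p, insert_index q j));
         c = vec (dim_row X - 1) (\<lambda>i. X $$ (insert_index p i, q))
     in X $$ (p, q) - r \<bullet> (mat_inv (mat_delete X p q) *\<^sub>v c))"

definition mdeg :: "nat \<Rightarrow> (nat \<Rightarrow> int) \<Rightarrow> int" where
  "mdeg m n = (\<Sum>i=1..m. n i)"

text \<open>The number \<open>|n| + m - 1\<close>, truncated to 0 in the degenerate case where every \<open>n i\<close> is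
  \<open>-1\<close>.\<close>

definition hp_order :: "nat \<Rightarrow> (nat \<Rightarrow> int) \<Rightarrow> nat" where
  "hp_order m n = nat (mdeg m n + int m - 1)"

text \<open>Degree with the convention that the zero polynomial has degree \<open>-1\<close>.\<close>

definition pdeg :: "'a::zero poly \<Rightarrow> int" where
  "pdeg p = (if p = 0 then -1 else int (degree p))"

definition hp_solution ::
  "nat \<Rightarrow> (nat \<Rightarrow> 'a::division_ring fps) \<Rightarrow> (nat \<Rightarrow> int) \<Rightarrow> (nat \<Rightarrow> 'a fps) \<Rightarrow> bool" where
  "hp_solution m f n Y \<longleftrightarrow>
    (\<forall>i\<in>{1..m}. \<exists>p. Y i = fps_of_poly p \<and> pdeg p \<le> n i) \<and>
    (\<exists>i\<in>{1..m}. Y i \<noteq> 0) \<and>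
    (\<exists>\<Gamma>. (\<Sum>i=1..m. f i * Y i) = fps_X ^ hp_order m n * \<Gamma>)"

text \<open>The columns in order, as pairs (block, column inside the block).\<close>

definition hp_cols :: "nat \<Rightarrow> (nat \<Rightarrow> int) \<Rightarrow> (nat \<times> nat) list" where
  "hp_cols m n = concat (map (\<lambda>i. map (\<lambda>c. (i, c)) [0..<nat (n i + 1)]) [1..<m + 1])"

definition last_col :: "(nat \<Rightarrow> int) \<Rightarrow> nat \<Rightarrow> nat" where
  "last_col n i = (\<Sum>l=1..i. nat (n l + 1)) - 1"

definition zcoeff :: "'a::zero fps \<Rightarrow> int \<Rightarrow> 'a" where
  "zcoeff g j = (if j < 0 then 0 else fps_nth g (nat j))"

definition hp_row :: "nat \<Rightarrow> (nat \<Rightarrow> 'a::zero fps) \<Rightarrow> (nat \<Rightarrow> int) \<Rightarrow> nat \<Rightarrow> 'a vec" where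
  "hp_row m f n r =
    vec (length (hp_cols m n)) (\<lambda>j. case hp_cols m n ! j of (i, c) \<Rightarrow> zcoeff (f i) (int r - int c))"

definition hp_matrix :: "nat \<Rightarrow> (nat \<Rightarrow> 'a::zero fps) \<Rightarrow> (nat \<Rightarrow> int) \<Rightarrow> 'a mat" where
  "hp_matrix m f n = mat_of_rows (length (hp_cols m n)) (map (hp_row m f n) [0..<hp_order m n])"

definition hp_matrix_ext :: "nat \<Rightarrow> (nat \<Rightarrow> 'a::zero fps) \<Rightarrow> (nat \<Rightarrow> int) \<Rightarrow> 'a mat" where
  "hp_matrix_ext m f n =
    hp_matrix m f n @\<^sub>r mat_of_rows (length (hp_cols m n)) [hp_row m f n (hp_order m n)]"

definition X_row :: "nat \<Rightarrow> (nat \<Rightarrow> int) \<Rightarrow> nat \<Rightarrow> 'a::ring_1 fps vec" where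
  "X_row m n k =
    vec (length (hp_cols m n)) (\<lambda>j. case hp_cols m n ! j of (i, c) \<Rightarrow> if i = k then fps_X ^ c else 0)"

definition X_matrix_ext ::
  "nat \<Rightarrow> (nat \<Rightarrow> 'a::ring_1 fps) \<Rightarrow> (nat \<Rightarrow> int) \<Rightarrow> nat \<Rightarrow> 'a fps mat" where
  "X_matrix_ext m f n k =
    map_mat fps_const (hp_matrix m f n) @\<^sub>r mat_of_rows (length (hp_cols m n)) [X_row m n k]"

text \<open>\<open>rho m f i n\<close> and \<open>Z m f i n k\<close> are meaningful for \<open>n i \<ge> 0\<close> only.\<close>

definition rho_exists :: "nat \<Rightarrow> (nat \<Rightarrow> 'a::division_ring fps) \<Rightarrow> nat \<Rightarrow> (nat \<Rightarrow> int) \<Rightarrow> bool" where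
  "rho_exists m f i n \<longleftrightarrow> quasidet_exists (hp_matrix_ext m f n) (hp_order m n) (last_col n i)"

definition rho :: "nat \<Rightarrow> (nat \<Rightarrow> 'a::division_ring fps) \<Rightarrow> nat \<Rightarrow> (nat \<Rightarrow> int) \<Rightarrow> 'a" where
  "rho m f i n = quasidet (hp_matrix_ext m f n) (hp_order m n) (last_col n i)"

text \<open>The inverse in \<^const>\<open>quasidet\<close> is here taken over \<open>'a fps\<close>; it is the inverse over
  \<open>'a\<close>, embedded by \<^const>\<open>fps_const\<close>, since inverses are unique.\<close>

definition Z :: "nat \<Rightarrow> (nat \<Rightarrow> 'a::division_ring fps) \<Rightarrow> nat \<Rightarrow> (nat \<Rightarrow> int) \<Rightarrow> nat \<Rightarrow> 'a fps" where
  "Z m f i n k = quasidet (X_matrix_ext m f n k) (hp_order m n) (last_col n i)"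

text \<open>The description below rests on the independence of the choice of \<open>i\<close>.\<close>

definition psi :: "nat \<Rightarrow> (nat \<Rightarrow> 'a::division_ring fps) \<Rightarrow> (nat \<Rightarrow> int) \<Rightarrow> nat \<Rightarrow> 'a fps" where
  "psi m f n k =
    (THE y. \<exists>i\<in>{1..m}. n i \<ge> 0 \<and> rho_exists m f i n \<and> rho m f i n \<noteq> 0 \<and>
       y = Z m f i n k * fps_const (inverse (rho m f i n)))"

definition perfect_system :: "nat \<Rightarrow> (nat \<Rightarrow> 'a::division_ring fps) \<Rightarrow> bool" where
  "perfect_system m f \<longleftrightarrow>
    (\<forall>n. (\<forall>i\<in>{1..m}. n i \<ge> 0) \<longrightarrow> (\<forall>i\<in>{1..m}. rho_exists m f i n \<and> rho m f i n \<noteq> 0))"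

definition add_unit :: "(nat \<Rightarrow> int) \<Rightarrow> nat \<Rightarrow> nat \<Rightarrow> int" where
  "add_unit n j = n(j := n j + 1)"

end

theory Submission
  imports Defs
begin

text \<open>For a fixed pivot column \<open>q\<close>, the quasideterminant at the last row is the last row applied to the
  unique vector \<open>y\<close> with \<open>y\<^sub>q = 1\<close> that is annihilated by all other rows. For \<open>q\<close> the last column of
  block \<open>i\<close>, the entries of \<open>y\<close> are the coefficients of the polynomials \<open>Z\<^sub>k\<close>, and \<open>\<rho>\<^sup>i(n)\<close> is the
  coefficient of \<open>x\<close> to the power \<open>|n| + m - 1\<close> in \<open>\<Sum> f\<^sub>k Z\<^sub>k\<close>. Hence \<open>\<psi>(n)\<close> is the unique tuple of
  polynomials of degree at most \<open>n\<close> for which \<open>\<Sum> f\<^sub>k \<psi>\<^sub>k\<close> has order \<open>|n| + m - 1\<close> and leading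
  coefficient 1, and \<open>\<psi>\<^sub>i(n)\<close> has top coefficient \<open>inverse (\<rho>\<^sup>i(n))\<close>.

  In the difference \<open>D\<close> of both sides of the recurrence the coefficients of degree \<open>n\<^sub>k + 1\<close> cancel, so \<open>D\<close>
  has degree at most \<open>n\<close>, while \<open>\<Sum> f\<^sub>k D\<^sub>k\<close> has order at least \<open>|n| + m\<close>; uniqueness gives
  \<open>D = 0\<close>. The second identity compares the coefficients at \<open>|n| + m\<close> in \<open>\<Sum> f\<^sub>k D\<^sub>k = 0\<close>.\<close>

section \<open>Quasideterminants and kernel vectors\<close>

text \<open>This makes the definite description in \<open>mat_inv\<close> usable.
  \<open>inverts_mat\<close> prescribes no size for the inverse, but comparing column counts in both
  products forces it to be square of size \<open>d\<close>; uniqueness is then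
  associativity.\<close>

lemma mat_inv_inverts:
  fixes B :: "'a::ring_1 mat"
  assumes B: "B \<in> carrier_mat d d" and inv: "invertible_mat B"
  shows "mat_inv B \<in> carrier_mat d d" "B * mat_inv B = 1\<^sub>m d" "mat_inv B * B = 1\<^sub>m d"
proof -
  have carrier: "C \<in> carrier_mat d d" if "inverts_mat B C" "inverts_mat C B" for C
  proof -
    have "dim_col C = d"
      using arg_cong[OF that(1)[unfolded inverts_mat_def], of dim_col] B by simp
    moreover have "dim_row C = d"
      using arg_cong[OF that(2)[unfolded inverts_mat_def], of dim_col] B by simp
    ultimately show ?thesis by auto
  qed
  obtain C where C: "inverts_mat B C" "inverts_mat C B"
    using inv unfolding invertible_mat_def by auto
  have "\<exists>!C. inverts_mat B C \<and> inverts_mat C B"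
  proof (rule ex1I[of _ C])
    fix C' assume C': "inverts_mat B C' \<and> inverts_mat C' B"
    have car: "C \<in> carrier_mat d d" "C' \<in> carrier_mat d d"
      using carrier C C' by auto
    have "C' = C' * (B * C)" using C car B by (auto simp: inverts_mat_def)
    also have "\<dots> = (C' * B) * C" using car B by (simp add: assoc_mult_mat)
    also have "\<dots> = C" using C' car by (auto simp: inverts_mat_def)
    finally show "C' = C" .
  qed (use C in auto)
  then have "inverts_mat B (mat_inv B) \<and> inverts_mat (mat_inv B) B"
    unfolding mat_inv_def by (rule theI')
  then show "mat_inv B \<in> carrier_mat d d" "B * mat_inv B = 1\<^sub>m d" "mat_inv B * B = 1\<^sub>m d"
    using carrier[of "mat_inv B"] B by (auto simp: inverts_mat_def)
qed

lemma sum_insert_index: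
  fixes g :: "nat \<Rightarrow> 'a::comm_monoid_add"
  assumes "q < Suc d"
  shows "(\<Sum>j<Suc d. g j) = g q + (\<Sum>j<d. g (insert_index q j))"
proof -
  have "(\<Sum>j<Suc d. g j) = g q + (\<Sum>j\<in>{0..<Suc d} - {q}. g j)"
    using assms by (subst sum.remove[of _ q]) (auto simp: atLeast0LessThan)
  also have "{0..<Suc d} - {q} = insert_index q ` {0..<d}"
    using insert_index_image[OF assms] by simp
  finally show ?thesis
    by (simp add: sum.reindex[OF insert_index_inj_on] atLeast0LessThan)
qed

lemma mat_delete_mult_vec_index:
  assumes X: "X \<in> carrier_mat (Suc d) (Suc d)" and q: "q < Suc d"
    and v: "v \<in> carrier_vec d" and i: "i < d"
  shows "(mat_delete X d q *\<^sub>v v) $ i = (\<Sum>j<d. X $$ (i, insert_index q j) * v $ j)"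
proof -
  have "mat_delete X d q \<in> carrier_mat d d"
    using mat_delete_carrier[OF X] by simp
  then have "dim_row (mat_delete X d q) = d" "dim_col (mat_delete X d q) = d" by auto
  then have "(mat_delete X d q *\<^sub>v v) $ i = (\<Sum>j<d. mat_delete X d q $$ (i, j) * v $ j)"
    using v i
    by (simp add: scalar_prod_def atLeast0LessThan)
  also have "\<dots> = (\<Sum>j<d. X $$ (i, insert_index q j) * v $ j)"
    using i mat_delete_index[OF X _ q i, of d, symmetric] by (intro sum.cong) auto
  finally show ?thesis .
qed

text \<open>Let \<open>B\<close> be the deleted matrix and \<open>w\<close> the solution of
  \<open>B w = c\<close> for the pivot column \<open>c\<close>. The vector with entry 1 at
  \<open>q\<close> and the entries of \<open>-w\<close> elsewhere is annihilated by the upper rows,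
  and pairing it with the last row gives exactly the formula for the quasideterminant.\<close>

lemma quasidet_kernel:
  fixes X :: "'a::ring_1 mat"
  assumes X: "X \<in> carrier_mat (Suc d) (Suc d)" and q: "q < Suc d"
    and ex: "quasidet_exists X d q"
  obtains y where "y q = 1" "\<And>i. i < d \<Longrightarrow> (\<Sum>j<Suc d. X $$ (i, j) * y j) = 0"
    "quasidet X d q = (\<Sum>j<Suc d. X $$ (d, j) * y j)"
proof -
  define B where "B = mat_delete X d q"
  define C where "C = mat_inv B"
  define c where "c = vec d (\<lambda>i. X $$ (insert_index d i, q))"
  define w where "w = C *\<^sub>v c"
  define y where "y = (\<lambda>j. if j = q then 1 else - w $ delete_index q j)"
  have B: "B \<in> carrier_mat d d"
    using mat_delete_carrier[OF X] by (simp add: B_def)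
  have C: "C \<in> carrier_mat d d" "B * C = 1\<^sub>m d"
    using mat_inv_inverts[OF B] ex by (auto simp: quasidet_exists_def B_def C_def)
  have c: "c \<in> carrier_vec d" by (simp add: c_def)
  have w: "w \<in> carrier_vec d" using C by (simp add: w_def carrier_vecI)
  have "B *\<^sub>v w = (B * C) *\<^sub>v c"
    unfolding w_def by (rule assoc_mult_mat_vec[OF B C(1) c, symmetric])
  then have Bw: "B *\<^sub>v w = c" using C c by simp
  have y: "(\<Sum>j<Suc d. X $$ (i, j) * y j) = X $$ (i, q) - (\<Sum>j<d. X $$ (i, insert_index q j) * w $ j)"
    for i
    by (simp add: sum_insert_index[OF q] y_def sum_negf del: sum.lessThan_Suc)
  show thesis
  proof
    show "y q = 1" by (simp add: y_def)
    show "(\<Sum>j<Suc d. X $$ (i, j) * y j) = 0" if i: "i < d" for i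
    proof -
      have "(\<Sum>j<d. X $$ (i, insert_index q j) * w $ j) = (B *\<^sub>v w) $ i"
        unfolding B_def by (rule mat_delete_mult_vec_index[OF X q w i, symmetric])
      also have "\<dots> = X $$ (i, q)" using i by (simp add: Bw c_def)
      finally show ?thesis unfolding y by simp
    qed
    show "quasidet X d q = (\<Sum>j<Suc d. X $$ (d, j) * y j)"
    proof -
      have "quasidet X d q = X $$ (d, q) - vec d (\<lambda>j. X $$ (d, insert_index q j)) \<bullet> w"
        using X by (simp add: quasidet_def Let_def flip: B_def C_def c_def w_def)
      then show ?thesis
        unfolding y using w by (simp add: scalar_prod_def atLeast0LessThan)
    qed
  qed
qed

text \<open>With the pivot entry zero, the remaining entries form a vector in the kernel of the
  deleted matrix, and its left inverse kills that kernel. Applied to differences, this gives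
  uniqueness of the kernel vector with entry 1 at \<open>q\<close>.\<close>

lemma quasidet_kernel_unique:
  fixes X :: "'a::ring_1 mat"
  assumes X: "X \<in> carrier_mat (Suc d) (Suc d)" and q: "q < Suc d"
    and ex: "quasidet_exists X d q"
    and z: "z q = 0" "\<And>i. i < d \<Longrightarrow> (\<Sum>j<Suc d. X $$ (i, j) * z j) = 0"
    and j: "j < Suc d"
  shows "z j = 0"
proof -
  define B where "B = mat_delete X d q"
  define v where "v = vec d (\<lambda>j. z (insert_index q j))"
  have B: "B \<in> carrier_mat d d"
    using mat_delete_carrier[OF X] by (simp add: B_def)
  note C = mat_inv_inverts[OF B ex[unfolded quasidet_exists_def, folded B_def]]
  have v: "v \<in> carrier_vec d" by (simp add: v_def)
  have "B *\<^sub>v v = 0\<^sub>v d"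
  proof (rule eq_vecI)
    fix i assume "i < dim_vec (0\<^sub>v d :: 'a vec)"
    then have i: "i < d" by simp
    have "(B *\<^sub>v v) $ i = (\<Sum>j<d. X $$ (i, insert_index q j) * z (insert_index q j))"
      unfolding B_def mat_delete_mult_vec_index[OF X q v i] by (simp add: v_def)
    also have "\<dots> = 0"
      using z(2)[OF i] z(1) by (simp add: sum_insert_index[OF q] del: sum.lessThan_Suc)
    finally show "(B *\<^sub>v v) $ i = 0\<^sub>v d $ i" using i by simp
  qed (use B in auto)
  then have "mat_inv B *\<^sub>v (B *\<^sub>v v) = 0\<^sub>v d"
    using C by (auto simp: scalar_prod_def)
  then have "v = 0\<^sub>v d"
    using C B v by (simp flip: assoc_mult_mat_vec)
  show ?thesis
  proof (cases "j = q")
    case False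
    then have "j \<in> insert_index q ` {0..<d}"
      using j insert_index_image[OF q] by auto
    then obtain j' where "j' < d" "j = insert_index q j'" by auto
    then show ?thesis using \<open>v = 0\<^sub>v d\<close> by (metis index_vec index_zero_vec(1) v_def)
  qed (use z in simp)
qed

text \<open>\<open>fps_const\<close> is a ring homomorphism, so it carries the inverse over
  \<open>'a\<close> to an inverse over \<open>'a fps\<close>, where the quasideterminant
  \<open>Z\<close> is formed.\<close>

lemma invertible_map_fps_const:
  fixes A :: "'a::ring_1 mat"
  assumes A: "A \<in> carrier_mat d d" and inv: "invertible_mat A"
  shows "invertible_mat (map_mat fps_const A)"
proof -
  have hom: "map_mat fps_const (B * C) = map_mat fps_const B * map_mat fps_const C"
    if "B \<in> carrier_mat d d" "C \<in> carrier_mat d d" for B C :: "'a mat"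
  proof -
    have "fps_const (sum h S) = (\<Sum>s\<in>S. fps_const (h s))" for h :: "nat \<Rightarrow> 'a" and S
      by (induction S rule: infinite_finite_induct) (auto simp flip: fps_const_add)
    then show ?thesis using that
      by (intro eq_matI) (auto simp: scalar_prod_def)
  qed
  have one: "map_mat fps_const (1\<^sub>m d) = (1\<^sub>m d :: 'a fps mat)"
    by (rule eq_matI) auto
  note C = mat_inv_inverts[OF A inv]
  have "inverts_mat (map_mat fps_const A) (map_mat fps_const (mat_inv A))"
    "inverts_mat (map_mat fps_const (mat_inv A)) (map_mat fps_const A)"
    using A C by (simp_all add: inverts_mat_def one flip: hom)
  then show ?thesis using A unfolding invertible_mat_def by auto
qed

section \<open>The columns of the block matrix\<close>

lemma hp_cols_0: "hp_cols 0 n = []"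
  by (simp add: hp_cols_def)

lemma hp_cols_Suc:
  "hp_cols (Suc m) n = hp_cols m n @ map (Pair (Suc m)) [0..<nat (n (Suc m) + 1)]"
  by (simp add: hp_cols_def)

lemma set_hp_cols: "set (hp_cols m n) = (SIGMA k:{1..m}. {c. int c \<le> n k})"
  by (auto simp: hp_cols_def)

lemma distinct_hp_cols: "distinct (hp_cols m n)"
  by (induction m) (auto simp: hp_cols_0 hp_cols_Suc distinct_map inj_on_def set_hp_cols)

lemma length_hp_cols: "length (hp_cols m n) = (\<Sum>l=1..m. nat (n l + 1))"
  by (induction m) (auto simp: hp_cols_0 hp_cols_Suc)

text \<open>\<open>last_col n i\<close> counts only the blocks up to \<open>i\<close>, so appending
  further blocks in the induction on \<open>m\<close> leaves it valid. Since \<open>n i\<close> is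
  nonnegative, block \<open>i\<close> is nonempty and the subtraction of 1 does not
  truncate.\<close>

lemma hp_cols_last_col:
  assumes "i \<in> {1..m}" "n i \<ge> 0"
  shows "last_col n i < length (hp_cols m n)" "hp_cols m n ! last_col n i = (i, nat (n i))"
proof -
  have "last_col n i < length (hp_cols m n) \<and> hp_cols m n ! last_col n i = (i, nat (n i))"
    using assms
  proof (induction m)
    case (Suc m)
    show ?case
    proof (cases "i = Suc m")
      case True
      have "last_col n i = length (hp_cols m n) + nat (n i)"
        using Suc.prems unfolding True by (simp add: last_col_def length_hp_cols nat_add_distrib)
      then show ?thesis
        using Suc.prems unfolding True by (auto simp: hp_cols_Suc nth_append)
    next
      case False
      then show ?thesis using Suc by (auto simp: hp_cols_Suc nth_append)
    qed
  qed simp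
  then show "last_col n i < length (hp_cols m n)" "hp_cols m n ! last_col n i = (i, nat (n i))"
    by auto
qed

lemma finite_int_le: "finite {c. int c \<le> b}"
  by (rule finite_subset[of _ "{..nat b}"]) auto

lemma sum_hp_cols:
  fixes g :: "nat \<times> nat \<Rightarrow> 'a::comm_monoid_add"
  shows "(\<Sum>j<length (hp_cols m n). g (hp_cols m n ! j)) = (\<Sum>k=1..m. \<Sum>c | int c \<le> n k. g (k, c))"
proof -
  have "(\<Sum>j<length (hp_cols m n). g (hp_cols m n ! j)) = sum g (set (hp_cols m n))"
    by (rule sum.reindex_bij_betw) (simp add: bij_betw_nth distinct_hp_cols)
  then show ?thesis
    by (simp add: set_hp_cols sum.Sigma finite_int_le)
qed

section \<open>Tuples of polynomials as coefficient vectors\<close>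

text \<open>Degree bounds are stated through vanishing coefficients, so that the linear algebra can
  stay inside \<open>'a fps\<close>; actual polynomials appear only when \<open>hp_solution\<close>
  is proved.\<close>

definition hp_bounded :: "nat \<Rightarrow> (nat \<Rightarrow> int) \<Rightarrow> (nat \<Rightarrow> 'a::zero fps) \<Rightarrow> bool" where
  "hp_bounded m n Q \<longleftrightarrow> (\<forall>k\<in>{1..m}. \<forall>c. int c > n k \<longrightarrow> fps_nth (Q k) c = 0)"

text \<open>The left-hand side of the Hermite-Pade condition. As the \<open>f k\<close> stand on the
  left, it is right linear in \<open>Q\<close>, which matches scalars acting from the right.\<close>

definition hp_remainder :: "nat \<Rightarrow> (nat \<Rightarrow> 'a::ring_1 fps) \<Rightarrow> (nat \<Rightarrow> 'a fps) \<Rightarrow> 'a fps" where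
  "hp_remainder m f Q = (\<Sum>k=1..m. f k * Q k)"

text \<open>The coefficients of \<open>Q\<close> listed in column order: the vector on which the
  rows of the matrices act.\<close>

definition hp_entry :: "nat \<Rightarrow> (nat \<Rightarrow> int) \<Rightarrow> (nat \<Rightarrow> 'a::zero fps) \<Rightarrow> nat \<Rightarrow> 'a" where
  "hp_entry m n Q j = (case hp_cols m n ! j of (k, c) \<Rightarrow> fps_nth (Q k) c)"

lemma fps_mult_nth_bounded:
  fixes g h :: "'a::ring_1 fps"
  assumes "\<And>c. int c > b \<Longrightarrow> fps_nth h c = 0"
  shows "fps_nth (g * h) r = (\<Sum>c | int c \<le> b. zcoeff g (int r - int c) * fps_nth h c)"
proof -
  have "fps_nth (g * h) r = (\<Sum>c\<le>r. fps_nth g (r - c) * fps_nth h c)"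
    unfolding fps_mult_nth atLeast0AtMost
    by (rule sum.reindex_bij_witness[of _ "\<lambda>c. r - c" "\<lambda>c. r - c"]) auto
  \<comment> \<open>The added terms have \<open>c > r\<close>, where \<open>zcoeff\<close> is 0 by
    its convention for negative indices. This frees the range of summation from
    \<open>r\<close>.\<close>
  also have "\<dots> = (\<Sum>c\<in>{..r} \<union> {c. int c \<le> b}. zcoeff g (int r - int c) * fps_nth h c)"
    using finite_int_le by (intro sum.mono_neutral_cong_left) (auto simp: zcoeff_def nat_diff_distrib)
  also have "\<dots> = (\<Sum>c | int c \<le> b. zcoeff g (int r - int c) * fps_nth h c)"
    using finite_int_le assms by (intro sum.mono_neutral_right) auto
  finally show ?thesis .
qed

lemma hp_row_entry:
  assumes "hp_bounded m n Q"
  shows "(\<Sum>j<length (hp_cols m n). hp_row m f n r $ j * hp_entry m n Q j)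
    = fps_nth (hp_remainder m f Q) r"
proof -
  have "(\<Sum>j<length (hp_cols m n). hp_row m f n r $ j * hp_entry m n Q j)
    = (\<Sum>j<length (hp_cols m n). (\<lambda>(k, c). zcoeff (f k) (int r - int c) * fps_nth (Q k) c) (hp_cols m n ! j))"
    by (intro sum.cong) (auto simp: hp_row_def hp_entry_def split: prod.splits)
  also have "\<dots> = fps_nth (hp_remainder m f Q) r"
    unfolding sum_hp_cols hp_remainder_def fps_sum_nth
    using assms by (auto simp: hp_bounded_def intro!: sum.cong fps_mult_nth_bounded[symmetric])
  finally show ?thesis .
qed

text \<open>The columns are distinct, so each pair (block, column) has one position
  \<open>J\<close>; the entry there is taken as the coefficient.\<close>

lemma ex_hp_entry:
  fixes y :: "nat \<Rightarrow> 'a::zero"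
  obtains Q where "hp_bounded m n Q" "\<And>j. j < length (hp_cols m n) \<Longrightarrow> hp_entry m n Q j = y j"
proof
  define J where "J = the_inv_into {..<length (hp_cols m n)} ((!) (hp_cols m n))"
  define Q where "Q = (\<lambda>k. Abs_fps (\<lambda>c. if int c \<le> n k then y (J (k, c)) else 0))"
  show "hp_bounded m n Q" by (auto simp: hp_bounded_def Q_def)
  fix j assume j: "j < length (hp_cols m n)"
  obtain k c where kc: "hp_cols m n ! j = (k, c)" by force
  have "int c \<le> n k" using nth_mem[OF j] unfolding kc set_hp_cols by auto
  moreover have "J (hp_cols m n ! j) = j"
    unfolding J_def using j
    by (intro the_inv_into_f_f inj_on_nth[OF distinct_hp_cols]) auto
  ultimately show "hp_entry m n Q j = y j"
    by (simp add: hp_entry_def kc Q_def)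
qed

text \<open>The row \<open>X_k\<close> selects block \<open>k\<close> and reassembles
  \<open>Q k\<close> from its coefficients, so it turns a kernel vector into a polynomial.\<close>

lemma X_row_entry:
  fixes Q :: "nat \<Rightarrow> 'a::ring_1 fps"
  assumes Q: "hp_bounded m n Q" and k: "k \<in> {1..m}"
  shows "(\<Sum>j<length (hp_cols m n). X_row m n k $ j * fps_const (hp_entry m n Q j)) = Q k"
proof -
  have "(\<Sum>j<length (hp_cols m n). X_row m n k $ j * fps_const (hp_entry m n Q j))
    = (\<Sum>j<length (hp_cols m n). (\<lambda>(i, c). if i = k then fps_X ^ c * fps_const (fps_nth (Q k) c) else 0) (hp_cols m n ! j))"
    by (intro sum.cong) (auto simp: X_row_def hp_entry_def split: prod.splits)
  also have "\<dots> = (\<Sum>i=1..m. if i = k then \<Sum>c | int c \<le> n k. fps_X ^ c * fps_const (fps_nth (Q k) c) else 0)"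
    unfolding sum_hp_cols by (intro sum.cong) auto
  also have "\<dots> = (\<Sum>c | int c \<le> n k. fps_X ^ c * fps_const (fps_nth (Q k) c))"
    using k by simp
  also have "\<dots> = Q k"
  proof (rule fps_ext)
    fix r
    have "fps_nth (\<Sum>c | int c \<le> n k. fps_X ^ c * fps_const (fps_nth (Q k) c)) r
      = (\<Sum>c | int c \<le> n k. if c = r then fps_nth (Q k) c else 0)"
      unfolding fps_sum_nth by (intro sum.cong) auto
    \<comment> \<open>If \<open>r\<close> exceeds \<open>n k\<close>, no index equals
      \<open>r\<close> and the sum is 0; the bound on \<open>Q\<close> makes the right side 0 as
      well.\<close>
    also have "\<dots> = fps_nth (Q k) r"
      using finite_int_le Q k by (simp add: hp_bounded_def)
    finally show "fps_nth (\<Sum>c | int c \<le> n k. fps_X ^ c * fps_const (fps_nth (Q k) c)) r = fps_nth (Q k) r" .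
  qed
  finally show ?thesis .
qed

section \<open>The extended matrices\<close>

text \<open>This says that the extended matrices are square. The hypotheses keep
  \<open>|n| + m - 1\<close> nonnegative, so \<open>hp_order\<close> is not truncated.\<close>

lemma length_hp_cols_eq:
  assumes "m \<ge> 1" "\<forall>i\<in>{1..m}. n i \<ge> 0"
  shows "length (hp_cols m n) = Suc (hp_order m n)"
proof -
  have "int (length (hp_cols m n)) = (\<Sum>l=1..m. n l + 1)"
    unfolding length_hp_cols of_nat_sum using assms(2) by (intro sum.cong) auto
  also have "\<dots> = mdeg m n + int m" by (simp add: mdeg_def sum.distrib)
  moreover have "mdeg m n \<ge> 0" using assms(2) by (auto simp: mdeg_def intro: sum_nonneg)
  ultimately show ?thesis using assms(1) by (simp add: hp_order_def)
qed

lemma hp_matrix_ext_carrier: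
  "hp_matrix_ext m f n \<in> carrier_mat (Suc (hp_order m n)) (length (hp_cols m n))"
proof -
  have "hp_matrix_ext m f n \<in> carrier_mat (hp_order m n + 1) (length (hp_cols m n))"
    unfolding hp_matrix_ext_def hp_matrix_def
    by (intro carrier_append_rows) (simp_all add: mat_of_rows_def)
  then show ?thesis by simp
qed

lemma X_matrix_ext_carrier:
  "X_matrix_ext m f n k \<in> carrier_mat (Suc (hp_order m n)) (length (hp_cols m n))"
proof -
  have "X_matrix_ext m f n k \<in> carrier_mat (hp_order m n + 1) (length (hp_cols m n))"
    unfolding X_matrix_ext_def hp_matrix_def
    by (intro carrier_append_rows) (simp_all add: mat_of_rows_def)
  then show ?thesis by simp
qed

lemma hp_matrix_ext_index:
  assumes "i \<le> hp_order m n" "j < length (hp_cols m n)"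
  shows "hp_matrix_ext m f n $$ (i, j) = hp_row m f n i $ j"
  using assms
  by (auto simp: hp_matrix_ext_def hp_matrix_def append_rows_def mat_of_rows_index)

lemma hp_matrix_ext_entry:
  assumes "hp_bounded m n Q" "r \<le> hp_order m n"
  shows "(\<Sum>j<length (hp_cols m n). hp_matrix_ext m f n $$ (r, j) * hp_entry m n Q j)
    = fps_nth (hp_remainder m f Q) r"
  unfolding hp_row_entry[OF assms(1), symmetric]
  by (intro sum.cong) (use assms(2) in \<open>auto simp: hp_matrix_ext_index\<close>)

lemma X_matrix_ext_index:
  assumes "i \<le> hp_order m n" "j < length (hp_cols m n)"
  shows "X_matrix_ext m f n k $$ (i, j)
    = (if i < hp_order m n then fps_const (hp_row m f n i $ j) else X_row m n k $ j)"
  using assms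
  by (auto simp: X_matrix_ext_def hp_matrix_def append_rows_def mat_of_rows_index)

text \<open>Deleting the last row removes the only difference: what is left is the deleted matrix of
  \<open>hp_matrix_ext\<close>, embedded by \<open>fps_const\<close>.\<close>

lemma quasidet_exists_X_matrix_ext:
  fixes f :: "nat \<Rightarrow> 'a::division_ring fps"
  assumes len: "length (hp_cols m n) = Suc (hp_order m n)"
    and q: "q < length (hp_cols m n)"
    and ex: "quasidet_exists (hp_matrix_ext m f n) (hp_order m n) q"
  shows "quasidet_exists (X_matrix_ext m f n k) (hp_order m n) q"
proof -
  let ?d = "hp_order m n"
  note H = hp_matrix_ext_carrier[of m f n, unfolded len]
  note X = X_matrix_ext_carrier[of m f n k, unfolded len]
  have "mat_delete (X_matrix_ext m f n k) ?d q
    = map_mat fps_const (mat_delete (hp_matrix_ext m f n) ?d q)"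
    using H X
    by (intro eq_matI) (auto simp: mat_delete_def X_matrix_ext_index hp_matrix_ext_index len)
  moreover have "mat_delete (hp_matrix_ext m f n) ?d q \<in> carrier_mat ?d ?d"
    using mat_delete_carrier[OF H] by simp
  ultimately show ?thesis
    using invertible_map_fps_const ex unfolding quasidet_exists_def by metis
qed

section \<open>The polynomials \<open>Z\<close> for a fixed pivot block\<close>

context
  fixes m :: nat and f :: "nat \<Rightarrow> 'a::division_ring fps" and n :: "nat \<Rightarrow> int" and i :: nat
  assumes m: "m \<ge> 1" and n: "\<forall>i\<in>{1..m}. n i \<ge> 0"
    and i: "i \<in> {1..m}" and ex: "rho_exists m f i n"
begin

lemma hp_kernel_trivial:
  assumes Q: "hp_bounded m n Q" and lead: "fps_nth (Q i) (nat (n i)) = 0"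
    and rem: "\<And>r. r < hp_order m n \<Longrightarrow> fps_nth (hp_remainder m f Q) r = 0"
    and k: "k \<in> {1..m}"
  shows "Q k = 0"
proof -
  note len = length_hp_cols_eq[OF m n]
  note lc = hp_cols_last_col[of i m n, OF i n[rule_format, OF i]]
  have z: "hp_entry m n Q j = 0" if "j < length (hp_cols m n)" for j
  proof (rule quasidet_kernel_unique[where X = "hp_matrix_ext m f n" and d = "hp_order m n"])
    show "hp_entry m n Q (last_col n i) = 0" by (simp add: hp_entry_def lc lead)
    show "(\<Sum>j<Suc (hp_order m n). hp_matrix_ext m f n $$ (r, j) * hp_entry m n Q j) = 0"
      if "r < hp_order m n" for r
      using that rem[OF that] hp_matrix_ext_entry[OF Q, of r f] by (simp add: len del: sum.lessThan_Suc)
  qed (use hp_matrix_ext_carrier[of m f n] lc ex that in \<open>auto simp: rho_exists_def len\<close>)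
  then show ?thesis using X_row_entry[OF Q k] by simp
qed

text \<open>\<open>Z\<close> and \<open>rho\<close> come from one kernel vector over
  \<open>'a\<close>. Reading it as a tuple \<open>Q\<close>, the rows of
  \<open>hp_matrix_ext\<close> yield the remainder coefficients and the rows \<open>X_k\<close>
  yield \<open>Q k\<close> itself.\<close>

lemma
  shows hp_bounded_Z: "hp_bounded m n (Z m f i n)"
    and Z_lead: "fps_nth (Z m f i n i) (nat (n i)) = 1"
    and Z_remainder: "r < hp_order m n \<Longrightarrow> fps_nth (hp_remainder m f (Z m f i n)) r = 0"
    and Z_remainder_order: "fps_nth (hp_remainder m f (Z m f i n)) (hp_order m n) = rho m f i n"
proof -
  let ?H = "hp_matrix_ext m f n" and ?d = "hp_order m n" and ?q = "last_col n i"
  note len = length_hp_cols_eq[OF m n]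
  note lc = hp_cols_last_col[of i m n, OF i n[rule_format, OF i]]
  have H: "?H \<in> carrier_mat (Suc ?d) (Suc ?d)" using hp_matrix_ext_carrier[of m f n] len by simp
  have q: "?q < Suc ?d" using lc len by simp
  obtain y where y: "y ?q = 1" "\<And>i. i < ?d \<Longrightarrow> (\<Sum>j<Suc ?d. ?H $$ (i, j) * y j) = 0"
    "quasidet ?H ?d ?q = (\<Sum>j<Suc ?d. ?H $$ (?d, j) * y j)"
    using quasidet_kernel[OF H q] ex unfolding rho_exists_def by blast
  obtain Q where Q: "hp_bounded m n Q"
    and Qy: "\<And>j. j < length (hp_cols m n) \<Longrightarrow> hp_entry m n Q j = y j"
    using ex_hp_entry by blast
  have row: "(\<Sum>j<Suc ?d. ?H $$ (r, j) * y j) = fps_nth (hp_remainder m f Q) r" if "r \<le> ?d" for r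
    unfolding hp_matrix_ext_entry[OF Q that, symmetric] len[symmetric] by (intro sum.cong) (auto simp: Qy)
  have const_sum: "(\<Sum>j\<in>S. fps_const (h j)) = fps_const (sum h S)" for h :: "nat \<Rightarrow> 'a" and S
    by (induction S rule: infinite_finite_induct) auto
  have ZQ: "Z m f i n k = Q k" if k: "k \<in> {1..m}" for k
  proof -
    let ?X = "X_matrix_ext m f n k"
    have X: "?X \<in> carrier_mat (Suc ?d) (Suc ?d)" using X_matrix_ext_carrier[of m f n k] len by simp
    have exX: "quasidet_exists ?X ?d ?q"
      using quasidet_exists_X_matrix_ext[OF len lc(1)] ex unfolding rho_exists_def by blast
    obtain y' where y': "y' ?q = 1" "\<And>i. i < ?d \<Longrightarrow> (\<Sum>j<Suc ?d. ?X $$ (i, j) * y' j) = 0"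
      "quasidet ?X ?d ?q = (\<Sum>j<Suc ?d. ?X $$ (?d, j) * y' j)"
      using quasidet_kernel[OF X q exX] by blast
    \<comment> \<open>The quasideterminant over \<open>'a fps\<close> brings its own kernel vector
      \<open>y'\<close>; uniqueness over \<open>'a fps\<close> shows that it consists of the
      constants \<open>y\<close>.\<close>
    have eq: "y' j - fps_const (y j) = 0" if "j < Suc ?d" for j
    proof (rule quasidet_kernel_unique[OF X q exX _ _ that])
      fix r assume r: "r < ?d"
      have "(\<Sum>j<Suc ?d. ?X $$ (r, j) * fps_const (y j)) = (\<Sum>j<Suc ?d. fps_const (?H $$ (r, j) * y j))"
        using r by (intro sum.cong)
          (auto simp: X_matrix_ext_index hp_matrix_ext_index len)
      also have "\<dots> = 0" unfolding const_sum using y(2)[OF r] by simp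
      finally show "(\<Sum>j<Suc ?d. ?X $$ (r, j) * (y' j - fps_const (y j))) = 0"
        using y'(2)[OF r] by (simp add: right_diff_distrib sum_subtractf del: sum.lessThan_Suc)
    qed (simp add: y y')
    have "Z m f i n k = (\<Sum>j<Suc ?d. X_row m n k $ j * fps_const (hp_entry m n Q j))"
      unfolding Z_def y'(3) using eq Qy
      by (intro sum.cong) (auto simp: X_matrix_ext_index len)
    then show ?thesis using X_row_entry[OF Q k] len by simp
  qed
  have rem: "hp_remainder m f (Z m f i n) = hp_remainder m f Q"
    unfolding hp_remainder_def using ZQ by (intro sum.cong) auto
  show "hp_bounded m n (Z m f i n)" using Q ZQ by (auto simp: hp_bounded_def)
  show "fps_nth (Z m f i n i) (nat (n i)) = 1"
    using Qy[OF lc(1)] y(1) ZQ[OF i] by (simp add: hp_entry_def lc)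
  show "r < ?d \<Longrightarrow> fps_nth (hp_remainder m f (Z m f i n)) r = 0"
    using row[of r] y(2)[of r] rem by simp
  show "fps_nth (hp_remainder m f (Z m f i n)) ?d = rho m f i n"
    using row[of ?d] y(3) rem unfolding rho_def by simp
qed

text \<open>With \<open>rho\<close> nonzero the full square matrix has trivial kernel. Subtracting
  from \<open>Q\<close> the right multiple of \<open>Z\<close> with the same top coefficient
  \<open>a\<close> in block \<open>i\<close> leaves a trivial tuple, and the remainder coefficient
  at \<open>hp_order m n\<close> then gives \<open>rho * a = 0\<close>.\<close>

lemma hp_overdetermined_trivial:
  assumes nz: "rho m f i n \<noteq> 0" and Q: "hp_bounded m n Q"
    and rem: "\<And>r. r \<le> hp_order m n \<Longrightarrow> fps_nth (hp_remainder m f Q) r = 0"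
    and k: "k \<in> {1..m}"
  shows "Q k = 0"
proof -
  define a where "a = fps_nth (Q i) (nat (n i))"
  define P where "P = (\<lambda>k. Q k - Z m f i n k * fps_const a)"
  have remP: "hp_remainder m f P = hp_remainder m f Q - hp_remainder m f (Z m f i n) * fps_const a"
    by (simp add: hp_remainder_def P_def right_diff_distrib sum_subtractf sum_distrib_right mult.assoc)
  have P: "P k = 0" if "k \<in> {1..m}" for k
  proof (rule hp_kernel_trivial[OF _ _ _ that])
    show "hp_bounded m n P" using Q hp_bounded_Z by (auto simp: hp_bounded_def P_def)
    show "fps_nth (P i) (nat (n i)) = 0" by (simp add: P_def a_def Z_lead)
    show "fps_nth (hp_remainder m f P) r = 0" if "r < hp_order m n" for r
      using that by (simp add: remP rem Z_remainder)
  qed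
  then have "hp_remainder m f P = 0" by (simp add: hp_remainder_def)
  then have "rho m f i n * a = 0"
    using arg_cong[OF remP, of "\<lambda>R. fps_nth R (hp_order m n)"] by (simp add: rem Z_remainder_order)
  then have "a = 0" using nz by simp
  then show ?thesis using P[OF k] by (simp add: P_def)
qed

end

section \<open>Right linearity of the remainder\<close>

lemma hp_remainder_mult_right:
  "hp_remainder m f (\<lambda>k. Q k * c) = hp_remainder m f Q * c"
  by (simp add: hp_remainder_def sum_distrib_right mult.assoc)

lemma hp_remainder_diff:
  "hp_remainder m f (\<lambda>k. P k - Q k) = hp_remainder m f P - hp_remainder m f Q"
  by (simp add: hp_remainder_def right_diff_distrib sum_subtractf)

lemma hp_remainder_sum:
  "hp_remainder m f (\<lambda>k. \<Sum>j\<in>J. Q j k) = (\<Sum>j\<in>J. hp_remainder m f (Q j))"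
  unfolding hp_remainder_def sum_distrib_left by (rule sum.swap)

lemma hp_remainder_fps_X:
  "hp_remainder m f (\<lambda>k. fps_X * Q k) = fps_X * hp_remainder m f Q"
proof -
  have "g * (fps_X * h) = fps_X * (g * h)" for g h :: "'a fps"
    by (metis mult.assoc fps_mult_fps_X_commute)
  then show ?thesis by (simp add: hp_remainder_def sum_distrib_left)
qed

section \<open>The normalised solution of a perfect system\<close>

context
  fixes m :: nat and f :: "nat \<Rightarrow> 'a::division_ring fps" and n :: "nat \<Rightarrow> int"
  assumes m: "m \<ge> 1" and perfect: "perfect_system m f" and n: "\<forall>i\<in>{1..m}. n i \<ge> 0"
begin

lemma perfect_rho:
  assumes "i \<in> {1..m}"
  shows "rho_exists m f i n" "rho m f i n \<noteq> 0"
  using perfect n assms unfolding perfect_system_def by blast+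

lemma perfect_trivial:
  assumes "hp_bounded m n Q" "\<And>r. r \<le> hp_order m n \<Longrightarrow> fps_nth (hp_remainder m f Q) r = 0"
    and "k \<in> {1..m}"
  shows "Q k = 0"
proof -
  have 1: "1 \<in> {1..m}" using m by simp
  show ?thesis
    using hp_overdetermined_trivial[OF m n 1 perfect_rho[OF 1]] assms by blast
qed

text \<open>Independence of the choice of \<open>i\<close>: after division by \<open>rho\<close>,
  the candidates for two indices have remainders that agree up to and including
  \<open>hp_order m n\<close>, so their difference is trivial.\<close>

lemma psi_eq_Z:
  assumes i: "i \<in> {1..m}" and k: "k \<in> {1..m}"
  shows "psi m f n k = Z m f i n k * fps_const (inverse (rho m f i n))"
  unfolding psi_def
proof (rule the_equality)
  show "\<exists>i'\<in>{1..m}. n i' \<ge> 0 \<and> rho_exists m f i' n \<and> rho m f i' n \<noteq> 0 \<and>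
       Z m f i n k * fps_const (inverse (rho m f i n)) = Z m f i' n k * fps_const (inverse (rho m f i' n))"
    using i n perfect_rho[OF i] by blast
  fix y assume "\<exists>i'\<in>{1..m}. n i' \<ge> 0 \<and> rho_exists m f i' n \<and> rho m f i' n \<noteq> 0 \<and>
       y = Z m f i' n k * fps_const (inverse (rho m f i' n))"
  then obtain i' where i': "i' \<in> {1..m}" and y: "y = Z m f i' n k * fps_const (inverse (rho m f i' n))"
    by blast
  define Q where "Q = (\<lambda>i k. Z m f i n k * fps_const (inverse (rho m f i n)))"
  have bounded: "hp_bounded m n (Q i)" if "i \<in> {1..m}" for i
    using hp_bounded_Z[OF m n that perfect_rho(1)[OF that]] by (simp add: Q_def hp_bounded_def)
  have Q: "fps_nth (hp_remainder m f (Q i)) r = (if r = hp_order m n then 1 else 0)"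
    if "i \<in> {1..m}" "r \<le> hp_order m n" for i r
    using that Z_remainder[OF m n that(1) perfect_rho(1)[OF that(1)], of r]
      Z_remainder_order[OF m n that(1) perfect_rho(1)[OF that(1)]] perfect_rho(2)[OF that(1)]
    by (auto simp: Q_def hp_remainder_mult_right)
  have "Q i' k - Q i k = 0"
  proof (rule perfect_trivial[OF _ _ k])
    show "hp_bounded m n (\<lambda>k. Q i' k - Q i k)"
      using bounded[OF i] bounded[OF i'] by (simp add: hp_bounded_def)
  qed (simp add: hp_remainder_diff Q[OF i] Q[OF i'])
  then show "y = Z m f i n k * fps_const (inverse (rho m f i n))"
    by (simp add: y Q_def)
qed

lemma psi_remainder_eq:
  assumes i: "i \<in> {1..m}"
  shows "hp_remainder m f (psi m f n) = hp_remainder m f (Z m f i n) * fps_const (inverse (rho m f i n))"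
proof -
  have "hp_remainder m f (psi m f n) = hp_remainder m f (\<lambda>k. Z m f i n k * fps_const (inverse (rho m f i n)))"
    unfolding hp_remainder_def by (rule sum.cong[OF refl]) (simp only: psi_eq_Z[OF i])
  then show ?thesis by (simp only: hp_remainder_mult_right)
qed

lemma psi_bounded: "k \<in> {1..m} \<Longrightarrow> int c > n k \<Longrightarrow> fps_nth (psi m f n k) c = 0"
  using hp_bounded_Z[OF m n, of k f] perfect_rho(1)[of k]
  unfolding hp_bounded_def by (simp only: psi_eq_Z fps_mult_right_const_nth) simp

text \<open>Here the pivot block is chosen to be \<open>k\<close> itself, where \<open>Z\<close> has
  top coefficient 1.\<close>

lemma psi_lead: "k \<in> {1..m} \<Longrightarrow> fps_nth (psi m f n k) (nat (n k)) = inverse (rho m f k n)"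
  using Z_lead[OF m n, of k f] perfect_rho(1)[of k]
  by (simp only: psi_eq_Z fps_mult_right_const_nth) simp

lemma psi_remainder:
  assumes "r \<le> hp_order m n"
  shows "fps_nth (hp_remainder m f (psi m f n)) r = (if r = hp_order m n then 1 else 0)"
proof -
  have i: "1 \<in> {1..m}" using m by simp
  show ?thesis
    using assms perfect_rho(2)[OF i] Z_remainder[OF m n i perfect_rho(1)[OF i], of r]
      Z_remainder_order[OF m n i perfect_rho(1)[OF i]]
    by (auto simp: psi_remainder_eq[OF i])
qed

lemma psi_hp_solution: "hp_solution m f n (psi m f n)"
  unfolding hp_solution_def
proof (intro conjI ballI)
  fix k assume k: "k \<in> {1..m}"
  define p where "p = Poly (map (fps_nth (psi m f n k)) [0..<Suc (nat (n k))])"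
  have nk: "n k \<ge> 0" using n k by blast
  have coeff: "coeff p c = fps_nth (psi m f n k) c" for c
  proof (cases "c < Suc (nat (n k))")
    case True
    then show ?thesis by (simp add: p_def nth_default_def del: upt_Suc)
  next
    case False
    then have "int c > n k" using nk by linarith
    then show ?thesis using False psi_bounded[OF k] by (simp add: p_def nth_default_def del: upt_Suc)
  qed
  have "degree p \<le> nat (n k)"
    using psi_bounded[OF k] nk by (intro degree_le) (auto simp: coeff)
  then have "pdeg p \<le> n k" using nk by (auto simp: pdeg_def)
  moreover have "psi m f n k = fps_of_poly p" by (rule fps_ext) (simp add: coeff)
  ultimately show "\<exists>p. psi m f n k = fps_of_poly p \<and> pdeg p \<le> n k" by blast
next
  have "1 \<in> {1..m}" using m by simp
  moreover from this have "psi m f n 1 \<noteq> 0" using psi_lead[of 1] perfect_rho(2)[of 1] by auto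
  ultimately show "\<exists>i\<in>{1..m}. psi m f n i \<noteq> 0" by blast
next
  let ?R = "hp_remainder m f (psi m f n)"
  \<comment> \<open>All coefficients below the order vanish, so shifting down and multiplying back
    loses nothing.\<close>
  have "?R = fps_X ^ hp_order m n * fps_shift (hp_order m n) ?R"
    by (rule fps_ext) (simp add: fps_X_power_mult_nth psi_remainder)
  then show "\<exists>\<Gamma>. (\<Sum>i=1..m. f i * psi m f n i) = fps_X ^ hp_order m n * \<Gamma>"
    unfolding hp_remainder_def by blast
qed

end

section \<open>The recurrence along the unit vectors\<close>

lemma hp_order_add_unit:
  assumes "m \<ge> 1" "\<forall>i\<in>{1..m}. n i \<ge> 0" "j \<in> {1..m}"
  shows "hp_order m (add_unit n j) = Suc (hp_order m n)"
proof -
  have "mdeg m (add_unit n j) = (\<Sum>i=1..m. n i + (if i = j then 1 else 0))"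
    unfolding mdeg_def add_unit_def by (intro sum.cong) auto
  then have "mdeg m (add_unit n j) = mdeg m n + 1"
    using assms(3) by (simp add: sum.distrib mdeg_def)
  moreover have "mdeg m n \<ge> 0" using assms(2) by (auto simp: mdeg_def intro: sum_nonneg)
  ultimately show ?thesis using assms(1) by (simp add: hp_order_def nat_add_distrib)
qed

theorem theorem4p1:
  fixes m :: nat and f :: "nat \<Rightarrow> 'a::division_ring fps" and n :: "nat \<Rightarrow> int"
  assumes "m \<ge> 1"
    and "perfect_system m f"
    and "\<forall>i\<in>{1..m}. n i \<ge> 0"
  shows "hp_solution m f n (psi m f n) \<and>
    (\<forall>k\<in>{1..m}. fps_X * psi m f n k =
      (\<Sum>j=1..m. psi m f (add_unit n j) k *
        fps_const (rho m f j (add_unit n j) * inverse (rho m f j n)))) \<and>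
    1 = (\<Sum>j=1..m. rho m f j (add_unit n j) * inverse (rho m f j n))"
proof -
  define g where "g = (\<lambda>j. rho m f j (add_unit n j) * inverse (rho m f j n))"
  define S where "S = (\<lambda>k. \<Sum>j=1..m. psi m f (add_unit n j) k * fps_const (g j))"
  define D where "D = (\<lambda>k. fps_X * psi m f n k - S k)"
  have n': "\<forall>i\<in>{1..m}. add_unit n j i \<ge> 0" for j
    using assms(3) by (auto simp: add_unit_def)
  note ord = hp_order_add_unit[OF assms(1,3)]
  have remD: "hp_remainder m f D = fps_X * hp_remainder m f (psi m f n)
      - (\<Sum>j=1..m. hp_remainder m f (psi m f (add_unit n j)) * fps_const (g j))"
    unfolding D_def S_def hp_remainder_diff hp_remainder_fps_X hp_remainder_sum
      hp_remainder_mult_right ..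
  \<comment> \<open>Each remainder of \<open>psi\<close> at \<open>n + e_j\<close> starts at
    \<open>Suc (hp_order m n)\<close> with coefficient 1, so there only the sum of the
    \<open>g j\<close> survives.\<close>
  have remS: "(\<Sum>j=1..m. fps_nth (hp_remainder m f (psi m f (add_unit n j))) r * g j)
      = (if r = Suc (hp_order m n) then \<Sum>j=1..m. g j else 0)" if "r \<le> Suc (hp_order m n)" for r
    using that by (auto simp: psi_remainder[OF assms(1,2) n'] ord intro!: sum.neutral)
  have bound: "hp_bounded m n D"
    unfolding hp_bounded_def
  proof (intro ballI allI impI)
    fix k c assume k: "k \<in> {1..m}" and c: "int c > n k"
    have nk: "n k \<ge> 0" using assms(3) k by blast
    have "c > 0" using c nk by linarith
    have coeff: "fps_nth (D k) c = fps_nth (psi m f n k) (c - 1)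
        - (\<Sum>j=1..m. fps_nth (psi m f (add_unit n j) k) c * g j)"
      using \<open>c > 0\<close> by (simp add: D_def S_def fps_sum_nth)
    \<comment> \<open>Among the \<open>n + e_j\<close> only \<open>j = k\<close> admits degree
      \<open>n k + 1\<close> in component \<open>k\<close>. There the top coefficient, the inverse
      of \<open>rho\<close> at \<open>n + e_k\<close>, cancels the left factor of \<open>g k\<close>
      and leaves the top coefficient of \<open>psi\<close> at \<open>n\<close>.\<close>
    have "fps_nth (psi m f (add_unit n j) k) c * g j
        = (if j = k then fps_nth (psi m f n k) (c - 1) else 0)" if j: "j \<in> {1..m}" for j
    proof (cases "j = k \<and> int c = n k + 1")
      case True
      then have "c - 1 = nat (n k)" "c = nat (add_unit n k k)"
        using nk by (auto simp: add_unit_def)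
      then have "fps_nth (psi m f n k) (c - 1) = inverse (rho m f k n)"
        "fps_nth (psi m f (add_unit n k) k) c = inverse (rho m f k (add_unit n k))"
        using psi_lead[OF assms k] psi_lead[OF assms(1,2) n' k, of k] by simp_all
      then show ?thesis
        using True perfect_rho(2)[OF assms(1,2) n' k, of k]
        by (simp add: g_def flip: mult.assoc)
    next
      case False
      then have "add_unit n j k < int c" using c by (auto simp: add_unit_def)
      then have "fps_nth (psi m f (add_unit n j) k) c = 0"
        using psi_bounded[OF assms(1,2) n' k] by blast
      moreover have "fps_nth (psi m f n k) (c - 1) = 0" if "j = k"
        using that False c \<open>c > 0\<close> by (intro psi_bounded[OF assms k]) (auto simp: of_nat_diff)
      ultimately show ?thesis by simp
    qed
    then show "fps_nth (D k) c = 0" unfolding coeff using k by simp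
  qed
  have D: "D k = 0" if "k \<in> {1..m}" for k
  proof (rule perfect_trivial[OF assms bound _ that])
    fix r assume r: "r \<le> hp_order m n"
    \<comment> \<open>Multiplication by \<open>fps_X\<close> moves index \<open>r\<close> to
      \<open>r - 1\<close>, strictly below the order; for \<open>r = 0\<close> the coefficient is 0
      outright.\<close>
    then have "fps_nth (fps_X * hp_remainder m f (psi m f n)) r = 0"
      using psi_remainder[OF assms, of "r - 1"] by (cases r) auto
    then show "fps_nth (hp_remainder m f D) r = 0"
      using r remS[of r] by (simp add: remD fps_sum_nth)
  qed
  then have "hp_remainder m f D = 0" by (simp add: hp_remainder_def)
  then have "1 = (\<Sum>j=1..m. g j)"
    using arg_cong[OF remD, of "\<lambda>R. fps_nth R (Suc (hp_order m n))"]
      remS[of "Suc (hp_order m n)"] psi_remainder[OF assms, of "hp_order m n"]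
    by (simp add: fps_sum_nth)
  moreover have "\<forall>k\<in>{1..m}. fps_X * psi m f n k = S k" using D by (simp add: D_def)
  ultimately show ?thesis
    using psi_hp_solution[OF assms] unfolding S_def g_def by blast
qed

end
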